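(* Let $1/2<\mu<1$. Given two points $x,y\in[0,1]$ with $x<y$, there exists $x_0\in(x,y)$ such that $h_\mu$ is discontinuous at $x_0$.
   Context: For $1/2<\mu\le 1$, $h_\mu:[0,1]\to[0,1]$ denotes the unique function from $[0,1]$ to $[0,1]$ satisfying the functional equation $h_\mu(x)=\tfrac12 h_\mu(2\mu x)$ for $0\le x\le 1/2$ and $h_\mu(x)=1-\tfrac12 h_\mu(2\mu(1-x))$ for $1/2<x\le 1$. (Existence and uniqueness follow from the contraction mapping theorem.) *)

theory Defs
  imports "HOL-Analysis.Analysis"
begin

(* A function on [0,1] is an element of the extensional function space
   {0..1} \<rightarrow>\<^sub>E {0..1}: its value outside [0,1] is fixed to "undefined",
   so that uniqueness on [0,1] is uniqueness as a HOL function. *)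
definition is_h :: "real \<Rightarrow> (real \<Rightarrow> real) \<Rightarrow> bool" where
  "is_h \<mu> f \<longleftrightarrow>
     f \<in> {0..1} \<rightarrow>\<^sub>E {0..1} \<and>
     (\<forall>x. 0 \<le> x \<and> x \<le> 1/2 \<longrightarrow> f x = 1/2 * f (2 * \<mu> * x)) \<and>
     (\<forall>x. 1/2 < x \<and> x \<le> 1 \<longrightarrow> f x = 1 - 1/2 * f (2 * \<mu> * (1 - x)))"

(* Meaningful for 1/2 < \<mu> \<le> 1; see is_h_h below. *)
definition h :: "real \<Rightarrow> real \<Rightarrow> real" where
  "h \<mu> = (THE f. is_h \<mu> f)"

lemma is_h_unique:
  assumes \<mu>: "1/2 < \<mu>" "\<mu> \<le> 1" and f: "is_h \<mu> f" and g: "is_h \<mu> g"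
  shows "f = g"
proof -
  have bound: "\<bar>f x - g x\<bar> \<le> (1/2)^n" if "x \<in> {0..1}" for x n
    using that
  proof (induction n arbitrary: x)
    case 0
    have "f x \<in> {0..1}" "g x \<in> {0..1}"
      using f g 0 unfolding is_h_def by (auto simp: PiE_iff simp del: atLeastAtMost_iff)
    then show ?case by auto
  next
    case (Suc n)
    show ?case
    proof (cases "x \<le> 1/2")
      case True
      have "\<mu> * x \<le> 1 * (1/2)" using True Suc.prems \<mu> by (intro mult_mono) auto
      then have "2 * \<mu> * x \<in> {0..1}" using Suc.prems \<mu> by auto
      moreover have "f x = 1/2 * f (2 * \<mu> * x)" "g x = 1/2 * g (2 * \<mu> * x)"
        using f g True Suc.prems unfolding is_h_def by auto
      moreover have "(1/2::real) ^ Suc n = 1/2 * (1/2)^n" by simp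
      ultimately show ?thesis using Suc.IH[of "2 * \<mu> * x"] by linarith
    next
      case False
      have "\<mu> * (1 - x) \<le> 1 * (1/2)" using False Suc.prems \<mu> by (intro mult_mono) auto
      then have "2 * \<mu> * (1 - x) \<in> {0..1}" using Suc.prems \<mu> by auto
      moreover have "f x = 1 - 1/2 * f (2 * \<mu> * (1 - x))"
        "g x = 1 - 1/2 * g (2 * \<mu> * (1 - x))"
        using f g False Suc.prems unfolding is_h_def by auto
      moreover have "(1/2::real) ^ Suc n = 1/2 * (1/2)^n" by simp
      ultimately show ?thesis using Suc.IH[of "2 * \<mu> * (1 - x)"] by linarith
    qed
  qed
  show ?thesis
  proof (rule PiE_ext)
    show "f \<in> {0..1} \<rightarrow>\<^sub>E {0..1}" "g \<in> {0..1} \<rightarrow>\<^sub>E {0..1}"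
      using f g by (auto simp: is_h_def)
    fix x :: real assume "x \<in> {0..1}"
    moreover have "(\<lambda>n. (1/2)^n) \<longlonglongrightarrow> (0::real)" by (intro LIMSEQ_power_zero) auto
    ultimately have "\<bar>f x - g x\<bar> \<le> 0"
      using bound by (intro LIMSEQ_le_const) auto
    then show "f x = g x" by simp
  qed
qed

lemma is_h_exists:
  assumes \<mu>: "1/2 < \<mu>" "\<mu> \<le> 1"
  shows "\<exists>f. is_h \<mu> f"
proof -
  define G :: "(real \<Rightarrow> real) \<Rightarrow> real \<Rightarrow> real" where
    "G = (\<lambda>f x. if x \<le> 1/2 then 1/2 * f (2 * \<mu> * x) else 1 - 1/2 * f (2 * \<mu> * (1 - x)))"
  define g where "g n = (G ^^ n) (\<lambda>_. 0)" for n
  have g0: "g 0 = (\<lambda>_. 0)" and gS: "\<And>n. g (Suc n) = G (g n)" by (simp_all add: g_def)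
  have range: "0 \<le> g n x \<and> g n x \<le> 1" for n x
  proof (induction n arbitrary: x)
    case (Suc n)
    have "g (Suc n) x = (if x \<le> 1/2 then 1/2 * g n (2 * \<mu> * x)
                         else 1 - 1/2 * g n (2 * \<mu> * (1 - x)))"
      by (simp add: gS G_def)
    then show ?case
      using Suc[of "2 * \<mu> * x"] Suc[of "2 * \<mu> * (1 - x)"] by (cases "x \<le> 1/2") (simp_all only: if_True if_False, linarith+)
  qed (simp add: g0)
  have step: "\<bar>g (Suc n) x - g n x\<bar> \<le> (1/2)^n" for n x
  proof (induction n arbitrary: x)
    case 0
    show ?case using range[of 1 x] by (simp add: g0)
  next
    case (Suc n)
    have eq: "g (Suc m) x = (if x \<le> 1/2 then 1/2 * g m (2 * \<mu> * x)
                         else 1 - 1/2 * g m (2 * \<mu> * (1 - x)))" for m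
      by (simp add: gS G_def)
    have "(1/2::real) ^ Suc n = 1/2 * (1/2)^n" by simp
    moreover have "g (Suc (Suc n)) x - g (Suc n) x =
        (if x \<le> 1/2 then 1/2 * (g (Suc n) (2 * \<mu> * x) - g n (2 * \<mu> * x))
         else - 1/2 * (g (Suc n) (2 * \<mu> * (1 - x)) - g n (2 * \<mu> * (1 - x))))"
      unfolding eq by (simp add: field_simps)
    ultimately show ?case
      using Suc[of "2 * \<mu> * x"] Suc[of "2 * \<mu> * (1 - x)"]
      by (simp add: abs_mult del: power_Suc)
  qed
  have "convergent (\<lambda>n. g n x)" for x
  proof -
    have "summable (\<lambda>n. g (Suc n) x - g n x)"
      by (rule summable_comparison_test'[of "\<lambda>n. (1/2)^n" 0]) (use step in auto)
    then have "convergent (\<lambda>n. \<Sum>k<n. g (Suc k) x - g k x)"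
      by (simp add: summable_iff_convergent)
    then show ?thesis unfolding sum_lessThan_telescope[of "\<lambda>n. g n x"] by (simp add: g0)
  qed
  then obtain l where l: "\<And>x. (\<lambda>n. g n x) \<longlonglongrightarrow> l x"
    unfolding convergent_def by metis
  have l01: "l x \<in> {0..1}" for x
    using LIMSEQ_le_const[OF l[of x], of 0] LIMSEQ_le_const2[OF l[of x], of 1] range by auto
  have lG: "l x = G l x" for x
  proof (rule LIMSEQ_unique)
    show "(\<lambda>n. g (Suc n) x) \<longlonglongrightarrow> l x" using l by (rule LIMSEQ_Suc)
    show "(\<lambda>n. g (Suc n) x) \<longlonglongrightarrow> G l x"
      by (cases "x \<le> 1/2") (auto simp: gS G_def intro!: tendsto_intros l)
  qed
  have m1: "2 * \<mu> * x \<in> {0..1}" if "0 \<le> x" "x \<le> 1/2" for x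
  proof -
    have "\<mu> * x \<le> 1 * (1/2)" using that \<mu> by (intro mult_mono) auto
    then show ?thesis using that \<mu> by auto
  qed
  have "is_h \<mu> (restrict l {0..1})"
    unfolding is_h_def
  proof (intro conjI allI impI)
    show "restrict l {0..1} \<in> {0..1} \<rightarrow>\<^sub>E {0..1}" using l01 by auto
  next
    fix x :: real assume "0 \<le> x \<and> x \<le> 1/2"
    then show "restrict l {0..1} x = 1/2 * restrict l {0..1} (2 * \<mu> * x)"
      using lG[of x] m1[of x] by (simp add: G_def restrict_def)
  next
    fix x :: real assume "1/2 < x \<and> x \<le> 1"
    then show "restrict l {0..1} x = 1 - 1/2 * restrict l {0..1} (2 * \<mu> * (1 - x))"
      using lG[of x] m1[of "1 - x"] by (simp add: G_def restrict_def)
  qed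
  then show ?thesis by blast
qed

lemma is_h_h:
  assumes "1/2 < \<mu>" "\<mu> \<le> 1"
  shows "is_h \<mu> (h \<mu>)"
  unfolding h_def using is_h_exists[OF assms] is_h_unique[OF assms] by (metis theI)

end

(* With T x = 2 * \<mu> * min x (1 - x), the function h satisfies h x = h (T x) / 2 on [0, 1/2] and
   h x = 1 - h (T x) / 2 on (1/2, 1]. Continuity at 1/2 would give h (1/2) = 1/2 by symmetry, so
   h \<mu> = 1 and h (T \<mu>) = 0. But h vanishes only at 0, because a zero stays in [0, 1/2] forever
   under T, whereas T \<mu> > 0 for \<mu> < 1. Finally, T maps an open interval of continuity missing
   1/2 onto an open interval of continuity that is 2 * \<mu> times longer, so every interval
   reaches the discontinuity at 1/2. *)
theory Submission
  imports Defs
begin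

lemma is_h_bounds:
  assumes "is_h \<mu> f" "0 \<le> x" "x \<le> 1"
  shows "0 \<le> f x" "f x \<le> 1"
proof -
  have "f x \<in> {0..1}"
    using assms unfolding is_h_def by (intro PiE_mem[of f "{0..1}"]) auto
  then show "0 \<le> f x" "f x \<le> 1" by auto
qed

lemma is_h_left:
  assumes "is_h \<mu> f" "0 \<le> x" "x \<le> 1/2"
  shows "f x = f (2 * \<mu> * x) / 2"
  using assms unfolding is_h_def by auto

lemma is_h_right:
  assumes "is_h \<mu> f" "1/2 < x" "x \<le> 1"
  shows "f x = 1 - f (2 * \<mu> * (1 - x)) / 2"
  using assms unfolding is_h_def by auto

lemma two_mu_mult_le_1:
  fixes \<mu> x :: real
  assumes "0 \<le> \<mu>" "\<mu> \<le> 1" "x \<le> 1/2"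
  shows "2 * \<mu> * x \<le> 1"
proof -
  have "\<mu> * x \<le> \<mu> * (1/2)" using assms by (intro mult_left_mono) auto
  then show ?thesis using assms by linarith
qed

text \<open>By the Archimedean property, the powers of \<open>a\<close> exceed \<open>1 / d\<close>
  for any positive \<open>d\<close>. With \<open>a = 2 * \<mu>\<close> this closes both expansion
  arguments below: for a zero of \<open>f\<close>, and for the length of an interval of
  continuity.\<close>

lemma nonpos_if_geometric_bounded:
  fixes a d :: real
  assumes "1 < a" and bounded: "\<And>n. a ^ n * d \<le> 1"
  shows "d \<le> 0"
proof (rule ccontr)
  assume "\<not> d \<le> 0"
  then have "0 < d" by simp
  obtain n where "1 / d < a ^ n" using real_arch_pow[OF \<open>1 < a\<close>] by blast
  with \<open>0 < d\<close> have "1 < a ^ n * d" by (simp add: field_simps)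
  with bounded[of n] show False by simp
qed

lemma is_h_eq_0:
  assumes \<mu>: "1/2 < \<mu>" "\<mu> \<le> 1" and f: "is_h \<mu> f"
    and x: "0 \<le> x" "x \<le> 1" and "f x = 0"
  shows "x = 0"
proof -
  \<comment> \<open>The left-hand side is the n-th iterate of the zero \<open>z\<close> under T,
    since only the left branch is ever used.\<close>
  have "(2 * \<mu>) ^ n * z \<le> 1" if "0 \<le> z" "z \<le> 1" "f z = 0" for n z
    using that
  proof (induction n arbitrary: z)
    case (Suc n)
    have le: "z \<le> 1/2"
    proof (rule ccontr)
      assume "\<not> z \<le> 1/2"
      then have half: "1/2 < z" by simp
      \<comment> \<open>This bound makes \<open>f z\<close> at least 1/2 on the right branch, so no
        zero lies there.\<close>
      have "f (2 * \<mu> * (1 - z)) \<le> 1"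
        using half Suc.prems \<mu> by (intro is_h_bounds[OF f] two_mu_mult_le_1) auto
      then show False using is_h_right[OF f half] Suc.prems by simp
    qed
    have "f (2 * \<mu> * z) = 0" using is_h_left[OF f _ le] Suc.prems by simp
    then have "(2 * \<mu>) ^ n * (2 * \<mu> * z) \<le> 1"
      using Suc.prems le \<mu> by (intro Suc.IH two_mu_mult_le_1) auto
    then show ?case by (simp only: power_Suc2 mult.assoc)
  qed simp
  then have "x \<le> 0"
    using assms by (intro nonpos_if_geometric_bounded[of "2 * \<mu>"]) auto
  with x show ?thesis by simp
qed

lemma is_h_not_isCont_half:
  assumes \<mu>: "1/2 < \<mu>" "\<mu> < 1" and f: "is_h \<mu> f"
  shows "\<not> isCont f (1/2)"
proof
  assume cont: "isCont f (1/2)"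
  \<comment> \<open>T sends both points to \<open>2 * \<mu> * (1/2 - t)\<close>. The case
    \<open>t = 0\<close> is excluded because 1/2 belongs to the left branch only; continuity has to
    supply it.\<close>
  have sym: "f (1/2 + t) = 1 - f (1/2 - t)" if "0 < t" "t \<le> 1/2" for t
    using is_h_left[OF f, of "1/2 - t"] is_h_right[OF f, of "1/2 + t"] that by simp
  have "((\<lambda>t. f (1/2 + t)) \<longlongrightarrow> f (1/2)) (at_right 0)"
    "((\<lambda>t. f (1/2 - t)) \<longlongrightarrow> f (1/2)) (at_right 0)"
    by (rule isCont_tendsto_compose[OF cont], rule tendsto_eq_intros, (rule tendsto_intros)+, simp)+
  then have "((\<lambda>t. f (1/2 + t) + f (1/2 - t)) \<longlongrightarrow> f (1/2) + f (1/2)) (at_right 0)"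
    by (rule tendsto_add)
  moreover have "((\<lambda>t. f (1/2 + t) + f (1/2 - t)) \<longlongrightarrow> 1) (at_right 0)"
  proof (rule tendsto_eventually)
    show "\<forall>\<^sub>F t in at_right 0. f (1/2 + t) + f (1/2 - t) = 1"
      unfolding eventually_at_right_field
    proof (intro exI conjI allI impI)
      show "0 < (1/2 :: real)" by simp
      show "f (1/2 + t) + f (1/2 - t) = 1" if "0 < t" "t < 1/2" for t
        using sym[of t] that by linarith
    qed
  qed
  ultimately have "f (1/2) + f (1/2) = 1"
    by (rule tendsto_unique[OF trivial_limit_at_right_real])
  then have "f (1/2) = 1/2" by linarith
  then have "f \<mu> = 1" using is_h_left[OF f, of "1/2"] by simp
  then have "f (2 * \<mu> * (1 - \<mu>)) = 0" using is_h_right[OF f, of \<mu>] \<mu> by simp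
  moreover have "0 \<le> 2 * \<mu> * (1 - \<mu>)" "2 * \<mu> * (1 - \<mu>) \<le> 1"
    using \<mu> by (auto intro: two_mu_mult_le_1)
  \<comment> \<open>The strict bound \<open>\<mu> < 1\<close> makes this impossible; at
    \<open>\<mu> = 1\<close> the product does vanish.\<close>
  ultimately have "2 * \<mu> * (1 - \<mu>) = 0"
    using \<mu> is_h_eq_0[OF _ _ f, of "2 * \<mu> * (1 - \<mu>)"] by linarith
  with \<mu> show False by simp
qed

text \<open>Solving the functional equation for the value at the image point gives
  \<open>f v = 2 * f (v / (2 * \<mu>))\<close>, so continuity passes forward along the
  branch.\<close>

lemma is_h_continuous_on_left:
  assumes "0 < \<mu>" and f: "is_h \<mu> f" and x: "0 \<le> x" and y: "y \<le> 1/2"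
    and cont: "continuous_on {x<..<y} f"
  shows "continuous_on {2 * \<mu> * x<..<2 * \<mu> * y} f"
proof (rule continuous_on_eq)
  have *: "v / (2 * \<mu>) \<in> {x<..<y}" if "v \<in> {2 * \<mu> * x<..<2 * \<mu> * y}" for v
    using that \<open>0 < \<mu>\<close> by (auto simp: field_simps)
  show "continuous_on {2 * \<mu> * x<..<2 * \<mu> * y} (\<lambda>v. 2 * f (v / (2 * \<mu>)))"
    using * \<open>0 < \<mu>\<close> by (intro continuous_intros continuous_on_compose2[OF cont]) auto
  fix v assume "v \<in> {2 * \<mu> * x<..<2 * \<mu> * y}"
  from *[OF this] x y have "0 \<le> v / (2 * \<mu>)" "v / (2 * \<mu>) \<le> 1/2"
    unfolding greaterThanLessThan_iff by linarith+
  from is_h_left[OF f this] \<open>0 < \<mu>\<close> show "2 * f (v / (2 * \<mu>)) = f v" by simp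
qed

text \<open>The same inversion on the decreasing branch, which swaps the endpoints. Since the
  interval is open, \<open>x = 1/2\<close> is allowed: all preimages stay strictly above
  1/2.\<close>

lemma is_h_continuous_on_right:
  assumes "0 < \<mu>" and f: "is_h \<mu> f" and x: "1/2 \<le> x" and y: "y \<le> 1"
    and cont: "continuous_on {x<..<y} f"
  shows "continuous_on {2 * \<mu> * (1 - y)<..<2 * \<mu> * (1 - x)} f"
proof (rule continuous_on_eq)
  let ?I = "{2 * \<mu> * (1 - y)<..<2 * \<mu> * (1 - x)}"
  have *: "1 - v / (2 * \<mu>) \<in> {x<..<y}" if "v \<in> ?I" for v
    using that \<open>0 < \<mu>\<close> by (auto simp: field_simps)
  show "continuous_on ?I (\<lambda>v. 2 * (1 - f (1 - v / (2 * \<mu>))))"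
    using * \<open>0 < \<mu>\<close> by (intro continuous_intros continuous_on_compose2[OF cont]) auto
  fix v assume "v \<in> ?I"
  from *[OF this] x y have "1/2 < 1 - v / (2 * \<mu>)" "1 - v / (2 * \<mu>) \<le> 1"
    unfolding greaterThanLessThan_iff by linarith+
  from is_h_right[OF f this] \<open>0 < \<mu>\<close> show "2 * (1 - f (1 - v / (2 * \<mu>))) = f v" by simp
qed

lemma is_h_not_continuous_on:
  assumes \<mu>: "1/2 < \<mu>" "\<mu> < 1" and f: "is_h \<mu> f"
    and "0 \<le> x" "x < y" "y \<le> 1"
  shows "\<not> continuous_on {x<..<y} f"
proof
  assume "continuous_on {x<..<y} f"
  \<comment> \<open>The endpoints are generalized because each induction step replaces the interval
    by its image under T, which again lies in [0, 1].\<close>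
  have "(2 * \<mu>) ^ n * (b - a) \<le> 1"
    if "0 \<le> a" "a < b" "b \<le> 1" "continuous_on {a<..<b} f" for n a b
    using that
  proof (induction n arbitrary: a b)
    case (Suc n)
    have "\<not> (a < 1/2 \<and> 1/2 < b)"
      using is_h_not_isCont_half[OF \<mu> f] Suc.prems
      by (auto simp: continuous_on_eq_continuous_at)
    then consider "b \<le> 1/2" | "1/2 \<le> a" by linarith
    then have "(2 * \<mu>) ^ n * (2 * \<mu> * (b - a)) \<le> 1"
    proof cases
      case 1
      have "(2 * \<mu>) ^ n * (2 * \<mu> * b - 2 * \<mu> * a) \<le> 1"
        using 1 Suc.prems \<mu>
        by (intro Suc.IH two_mu_mult_le_1 is_h_continuous_on_left[OF _ f]) auto
      then show ?thesis by (simp add: algebra_simps)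
    next
      case 2
      have "(2 * \<mu>) ^ n * (2 * \<mu> * (1 - a) - 2 * \<mu> * (1 - b)) \<le> 1"
        using 2 Suc.prems \<mu>
        by (intro Suc.IH two_mu_mult_le_1 is_h_continuous_on_right[OF _ f]) auto
      then show ?thesis by (simp add: algebra_simps)
    qed
    then show ?case by (simp only: power_Suc2 mult.assoc)
  qed simp
  then have "y - x \<le> 0"
    using assms \<open>continuous_on {x<..<y} f\<close>
    by (intro nonpos_if_geometric_bounded[of "2 * \<mu>"]) auto
  with \<open>x < y\<close> show False by simp
qed

theorem corollary2p16:
  fixes \<mu> x y :: real
  assumes "1/2 < \<mu>" and "\<mu> < 1"
    and "x \<in> {0..1}" and "y \<in> {0..1}" and "x < y"
  shows "\<exists>x\<^sub>0\<in>{x<..<y}. \<not> continuous (at x\<^sub>0 within {0..1}) (h \<mu>)"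
proof (rule ccontr)
  assume "\<not> ?thesis"
  then have "continuous (at z within {0..1}) (h \<mu>)" if "z \<in> {x<..<y}" for z
    using that by blast
  moreover have "{x<..<y} \<subseteq> {0..1}" using assms(3,4) by auto
  \<comment> \<open>Continuity relative to [0, 1] restricts to the smaller set.\<close>
  ultimately have "continuous_on {x<..<y} (h \<mu>)"
    unfolding continuous_on_eq_continuous_within by (metis continuous_within_subset)
  moreover have "is_h \<mu> (h \<mu>)" using assms by (intro is_h_h) auto
  ultimately show False using is_h_not_continuous_on[of \<mu> "h \<mu>" x y] assms by auto
qed

end
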